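(* Let $m\in\mathbb{N}$ and $M_k\ge 0$ for $k=1,2,\ldots,m-1$. Let $F(z)=\sum_{k=0}^{m-1}|z|^{2k} f_k(z)$ be a reduced poly-analytic function of order $m$ in the unit disk $\mathbb{D}$, where all the $f_k$ are holomorphic in $\mathbb{D}$, satisfying $F_z(0)=1$ and $f_k(0)=0$ for $k\in\{0,1,2,\ldots,m-1\}$. Suppose that $|f_0'(z)|<M_0$ for some $M_0>0$ and all $z\in\mathbb{D}$, and $|f_k'(z)|\le M_k$ for all $k\in\{1,2,\ldots,m-1\}$ and all $z\in\mathbb{D}$. Then $M_0>1$, $F$ is univalent in $\mathbb{D}_{r_5}$, and $F(\mathbb{D}_{r_5})$ contains the schlicht disk $\mathbb{D}_{r_6}$, where $r_5$ is the unique root in $(0,1)$ of the equation $$M_0\frac{1-M_0 r}{M_0-r}-\sum_{k=1}^{m-1}M_k(2k+1)r^{2k}=0$$ and $$r_6=M_0^2 r_5+(M_0^3-M_0)\log\left(1-\frac{r_5}{M_0}\right)-\sum_{k=1}^{m-1}M_k r_5^{2k+1}.$$ The result is sharp, with an extremal function given by $$G_4(z)=M_0^2 z+(M_0^3-M_0)\log\left(1-\frac{z}{M_0}\right)-\sum_{k=1}^{m-1}|z|^{2k}M_k z;$$ that is (for $M_0>1$), $G_4$ satisfies all the hypotheses above, $G_4$ is not univalent in $\mathbb{D}_r$ for any $r\in(r_5,1]$, and $G_4(\mathbb{D}_{r_5})$ contains no disk $\mathbb{D}_\rho$ with $\rho>r_6$.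
   Context: $\mathbb{D}_r=\{z\in\mathbb{C}:|z|<r\}$ and $\mathbb{D}=\mathbb{D}_1$; $\mathbb{N}=\{1,2,\ldots\}$. A reduced poly-analytic function of order $m$ in a domain $\Omega$ is a function of the form $F(z)=\sum_{k=0}^{m-1}|z|^{2k} f_k(z)$ with all $f_k$ analytic in $\Omega$. $F_z$ and $F_{\overline z}$ denote the Wirtinger derivatives $\frac12(F_x-iF_y)$ and $\frac12(F_x+iF_y)$. Univalent means injective. A schlicht disk in the image of $F$ is a disk that is the univalent image under $F$ of some region in the domain. $\log$ is the principal branch. Empty sums are $0$. *)

theory Defs
  imports "HOL-Complex_Analysis.Complex_Analysis"
begin

text \<open>The Wirtinger derivative \<open>F\<^sub>z = (F\<^sub>x - i F\<^sub>y) / 2\<close>, from the real partial derivatives.\<close>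

definition wirtinger_z :: "(complex \<Rightarrow> complex) \<Rightarrow> complex \<Rightarrow> complex" where
  "wirtinger_z F z =
     (vector_derivative (\<lambda>t::real. F (z + of_real t)) (at 0)
      - \<i> * vector_derivative (\<lambda>t::real. F (z + \<i> * of_real t)) (at 0)) / 2"

definition reduced_poly_analytic ::
    "nat \<Rightarrow> complex set \<Rightarrow> (nat \<Rightarrow> complex \<Rightarrow> complex) \<Rightarrow> (complex \<Rightarrow> complex) \<Rightarrow> bool" where
  "reduced_poly_analytic m \<Omega> f F \<longleftrightarrow>
     (\<forall>k<m. f k holomorphic_on \<Omega>) \<and>
     (\<forall>z\<in>\<Omega>. F z = (\<Sum>k<m. of_real (cmod z ^ (2 * k)) * f k z))"

text \<open>A region is an open connected set; \<open>U\<close> is nonempty since its image is a disk of positive radius.\<close>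

definition contains_schlicht_disk ::
    "(complex \<Rightarrow> complex) \<Rightarrow> complex set \<Rightarrow> complex \<Rightarrow> real \<Rightarrow> bool" where
  "contains_schlicht_disk F D c \<rho> \<longleftrightarrow>
     \<rho> > 0 \<and>
     (\<exists>U. U \<subseteq> D \<and> open U \<and> connected U \<and> inj_on F U \<and> F ` U = ball c \<rho>)"

text \<open>In what follows the entry \<open>M 0\<close> of the sequence \<open>M\<close> is the strict bound on \<open>f\<^sub>0'\<close>;
  the entries \<open>M k\<close> with \<open>1 \<le> k < m\<close> are the non-strict bounds on \<open>f\<^sub>k'\<close>.\<close>

definition bloch_hypotheses ::
    "nat \<Rightarrow> (nat \<Rightarrow> real) \<Rightarrow> (nat \<Rightarrow> complex \<Rightarrow> complex) \<Rightarrow> (complex \<Rightarrow> complex) \<Rightarrow> bool" where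
  "bloch_hypotheses m M f F \<longleftrightarrow>
     reduced_poly_analytic m (ball 0 1) f F \<and>
     wirtinger_z F 0 = 1 \<and>
     (\<forall>k<m. f k 0 = 0) \<and>
     M 0 > 0 \<and>
     (\<forall>z\<in>ball 0 1. cmod (deriv (f 0) z) < M 0) \<and>
     (\<forall>k\<in>{1..<m}. \<forall>z\<in>ball 0 1. cmod (deriv (f k) z) \<le> M k)"

definition is_r5 :: "nat \<Rightarrow> (nat \<Rightarrow> real) \<Rightarrow> real \<Rightarrow> bool" where
  "is_r5 m M r \<longleftrightarrow>
     0 < r \<and> r < 1 \<and>
     M 0 * ((1 - M 0 * r) / (M 0 - r))
       - (\<Sum>k\<in>{1..<m}. M k * real (2 * k + 1) * r ^ (2 * k)) = 0"

definition r6 :: "nat \<Rightarrow> (nat \<Rightarrow> real) \<Rightarrow> real \<Rightarrow> real" where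
  "r6 m M r5 =
     (M 0)\<^sup>2 * r5 + ((M 0) ^ 3 - M 0) * ln (1 - r5 / M 0)
       - (\<Sum>k\<in>{1..<m}. M k * r5 ^ (2 * k + 1))"

definition G4 :: "nat \<Rightarrow> (nat \<Rightarrow> real) \<Rightarrow> complex \<Rightarrow> complex" where
  "G4 m M z =
     of_real ((M 0)\<^sup>2) * z + of_real ((M 0) ^ 3 - M 0) * Ln (1 - z / of_real (M 0))
       - (\<Sum>k\<in>{1..<m}. of_real (cmod z ^ (2 * k)) * of_real (M k) * z)"

end

theory Submission
  imports Defs
begin

text \<open>The root \<open>r5\<close> is where \<open>phi\<close>, the derivative of \<open>r6\<close>, changes sign. By the Schwarz-Pick lemma
  for \<open>f\<^sub>0' / M\<^sub>0\<close>, \<open>Re f\<^sub>0' \<ge> M\<^sub>0 (1 - M\<^sub>0 s) / (M\<^sub>0 - s)\<close> on \<open>|z| \<le> s\<close>, while \<open>|z|\<^bsup>2k\<^esup> f\<^sub>k\<close> has Lipschitz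
  constant \<open>M\<^sub>k (2k + 1) s\<^bsup>2k\<^esup>\<close> there; hence \<open>F\<close> expands distances by at least the factor \<open>phi s > 0\<close>
  for \<open>s < r5\<close>. Integrating the bound on \<open>Re f\<^sub>0'\<close> along radii gives \<open>|F z| \<ge> r6\<close> on \<open>|z| = r5\<close>, so by
  invariance of domain the image covers the disk of radius \<open>r6\<close>. On the positive axis \<open>G4\<close> coincides
  with \<open>r6\<close>, which increases up to \<open>r5\<close> and decreases afterwards.\<close>

section \<open>The real functions \<open>phi\<close> and \<open>r6\<close>: signs, roots and
  monotonicity\<close>

definition phi :: "nat \<Rightarrow> (nat \<Rightarrow> real) \<Rightarrow> real \<Rightarrow> real" where
  "phi m M r = M 0 * ((1 - M 0 * r) / (M 0 - r))
     - (\<Sum>k\<in>{1..<m}. M k * real (2 * k + 1) * r ^ (2 * k))"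

lemma is_r5_iff: "is_r5 m M r \<longleftrightarrow> 0 < r \<and> r < 1 \<and> phi m M r = 0"
  by (simp add: is_r5_def phi_def)

text \<open>Division with remainder turns the quotient into a constant minus
  \<open>(a ^ 3 - a) / (a - t)\<close>. The numerator is positive because \<open>a > 1\<close>, and
  the denominator shrinks as \<open>t\<close> grows.\<close>

lemma moebius_antimono:
  fixes a x y :: real
  assumes "a > 1" "x < y" "y \<le> 1"
  shows "a * ((1 - a * y) / (a - y)) < a * ((1 - a * x) / (a - x))"
proof -
  have eq: "a * ((1 - a * t) / (a - t)) = a\<^sup>2 - (a ^ 3 - a) / (a - t)" if "t \<le> 1" for t
    using that assms by (simp add: field_simps power2_eq_square power3_eq_cube)
  have "a ^ 3 - a = a * (a - 1) * (a + 1)"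
    by (simp add: algebra_simps power3_eq_cube)
  then have "a ^ 3 - a > 0"
    using assms by simp
  then have "(a ^ 3 - a) / (a - x) < (a ^ 3 - a) / (a - y)"
    using assms by (intro divide_strict_left_mono mult_pos_pos) auto
  then show ?thesis
    using eq assms by simp
qed

lemma phi_strict_decreasing:
  assumes "M 0 > 1" "\<forall>k\<in>{1..<m}. M k \<ge> 0" "0 \<le> x" "x < y" "y \<le> 1"
  shows "phi m M y < phi m M x"
proof -
  have "(\<Sum>k\<in>{1..<m}. M k * real (2 * k + 1) * x ^ (2 * k))
      \<le> (\<Sum>k\<in>{1..<m}. M k * real (2 * k + 1) * y ^ (2 * k))"
    using assms by (intro sum_mono mult_left_mono power_mono) auto
  with moebius_antimono[of "M 0" x y] show ?thesis
    using assms by (simp add: phi_def)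
qed

text \<open>Existence is the intermediate value theorem, \<open>phi\<close> being positive at 0 and
  negative at 1; uniqueness is strict monotonicity.\<close>

lemma ex1_is_r5:
  assumes "M 0 > 1" "\<forall>k\<in>{1..<m}. M k \<ge> 0"
  shows "\<exists>!r. is_r5 m M r"
proof -
  \<comment> \<open>All indices are at least 1, so the powers of 0 vanish and the value at 0 is
    1.\<close>
  have phi0: "phi m M 0 > 0"
    using assms by (simp add: phi_def power_0_left)
  have "(1 - M 0) / (M 0 - 1) = -1"
    using assms by (simp add: field_simps)
  moreover have "(\<Sum>k\<in>{1..<m}. M k * real (2 * k + 1)) \<ge> 0"
    using assms by (intro sum_nonneg mult_nonneg_nonneg) auto
  ultimately have phi1: "phi m M 1 < 0"
    using assms by (simp add: phi_def)
  have "continuous_on {0..1} (phi m M)"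
    unfolding phi_def using assms by (intro continuous_intros) auto
  then obtain r where r: "0 \<le> r" "r \<le> 1" "phi m M r = 0"
    using IVT2'[of "phi m M" 1 0 0] phi0 phi1 by auto
  then have "is_r5 m M r"
    using phi0 phi1 by (auto simp: is_r5_iff less_le)
  moreover have "s = r" if "is_r5 m M s" for s
    using that r phi_strict_decreasing[OF assms, of s r] phi_strict_decreasing[OF assms, of r s]
    by (cases s r rule: linorder_cases) (auto simp: is_r5_iff)
  ultimately show ?thesis
    by blast
qed

text \<open>Only \<open>x < M 0\<close> is required, so with \<open>M 0 > 1\<close> the derivative
  is two-sided even at the endpoints 0 and 1.\<close>

lemma r6_has_derivative:
  assumes "M 0 > 1" "x < M 0"
  shows "(r6 m M has_real_derivative phi m M x) (at x)"
proof -
  have frac_eq: "(M 0)\<^sup>2 + (M 0 ^ 3 - M 0) * (1 / (1 - x / M 0) * - (1 / M 0))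
      = M 0 * ((1 - M 0 * x) / (M 0 - x))"
    using assms by (simp add: field_simps power2_eq_square power3_eq_cube)
  have "((\<lambda>r. (M 0)\<^sup>2 * r + ((M 0) ^ 3 - M 0) * ln (1 - r / M 0)) has_real_derivative
      (M 0)\<^sup>2 + (M 0 ^ 3 - M 0) * (1 / (1 - x / M 0) * - (1 / M 0))) (at x)"
    using assms by (auto intro!: derivative_eq_intros)
  moreover have "((\<lambda>r. r ^ (2 * k + 1)) has_real_derivative real (2 * k + 1) * x ^ (2 * k)) (at x)" for k
    using DERIV_pow[of "2 * k + 1" x] by simp
  then have "((\<lambda>r. \<Sum>k\<in>{1..<m}. M k * r ^ (2 * k + 1)) has_real_derivative
      (\<Sum>k\<in>{1..<m}. M k * (real (2 * k + 1) * x ^ (2 * k)))) (at x)"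
    by (intro DERIV_sum DERIV_cmult)
  ultimately show ?thesis
    unfolding r6_def[abs_def] phi_def frac_eq mult.assoc by (rule DERIV_diff)
qed

lemma r6_continuous_on:
  assumes "M 0 > 1" shows "continuous_on {0..1} (r6 m M)"
  using assms r6_has_derivative[of M]
  by (intro DERIV_atLeastAtMost_imp_continuous_on) (meson less_le_trans not_le)

lemma r6_zero: "r6 m M 0 = 0"
  by (simp add: r6_def)

lemma r6_increasing:
  assumes "M 0 > 1" "\<forall>k\<in>{1..<m}. M k \<ge> 0" "is_r5 m M r" "0 \<le> x" "x < r"
  shows "r6 m M x < r6 m M r"
proof (rule DERIV_pos_imp_increasing_open[of x r "r6 m M"])
  show "continuous_on {x..r} (r6 m M)"
    using assms by (intro continuous_on_subset[OF r6_continuous_on]) (auto simp: is_r5_iff)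
  fix y assume "x < y" "y < r"
  then show "\<exists>d. (r6 m M has_real_derivative d) (at y) \<and> d > 0"
    using assms phi_strict_decreasing[OF assms(1,2), of y r] r6_has_derivative[of M y m]
    by (auto simp: is_r5_iff)
qed (use assms in auto)

lemma r6_decreasing:
  assumes "M 0 > 1" "\<forall>k\<in>{1..<m}. M k \<ge> 0" "is_r5 m M r" "r < x" "x \<le> 1"
  shows "r6 m M x < r6 m M r"
proof (rule DERIV_neg_imp_decreasing_open[of r x "r6 m M"])
  show "continuous_on {r..x} (r6 m M)"
    using assms by (intro continuous_on_subset[OF r6_continuous_on]) (auto simp: is_r5_iff)
  fix y assume "r < y" "y < x"
  then show "\<exists>d. (r6 m M has_real_derivative d) (at y) \<and> d < 0"
    using assms phi_strict_decreasing[OF assms(1,2), of r y] r6_has_derivative[of M y m]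
    by (auto simp: is_r5_iff)
qed (use assms in auto)

section \<open>General analytic estimates\<close>

text \<open>The Schwarz lemma, applied after the disk automorphism taking \<open>a\<close> to 0,
  confines \<open>h z\<close> to a pseudo-hyperbolic disk about \<open>a\<close> of radius
  \<open>cmod z\<close>. Its leftmost point is real and equals the stated bound.\<close>

lemma Schwarz_Pick_Re:
  assumes hol: "h holomorphic_on ball 0 1" and lt: "\<And>z. cmod z < 1 \<Longrightarrow> cmod (h z) < 1"
    and h0: "h 0 = of_real a" and z: "cmod z < 1"
  shows "Re (h z) \<ge> (a - cmod z) / (1 - a * cmod z)"
proof -
  define g where "g = (\<lambda>z. (h z - of_real a) / (1 - of_real a * h z))"
  have a: "\<bar>a\<bar> < 1"
    using lt[of 0] h0 by simp
  have ah: "cmod (of_real a * h z) < 1" if "cmod z < 1" for z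
    using mult_strict_mono'[OF a lt[OF that]] by (simp add: norm_mult)
  then have nz: "1 - of_real a * h z \<noteq> 0" if "cmod z < 1" for z
    using that by fastforce
  \<comment> \<open>This identity shows that the automorphism maps the unit disk into
    itself.\<close>
  have id: "(cmod (1 - of_real a * w))\<^sup>2 - (cmod (w - of_real a))\<^sup>2
      = (1 - a\<^sup>2) * (1 - (cmod w)\<^sup>2)" for w
    unfolding cmod_power2 by (simp add: algebra_simps power2_eq_square)
  have "g holomorphic_on ball 0 1"
    unfolding g_def using nz by (intro holomorphic_intros hol) auto
  moreover have "g 0 = 0"
    by (simp add: g_def h0)
  moreover have "cmod (g z) < 1" if "cmod z < 1" for z
  proof -
    have "(1 - a\<^sup>2) * (1 - (cmod (h z))\<^sup>2) > 0"
      using a lt[OF that] by (intro mult_pos_pos) (auto simp: abs_square_less_1 power_less_one_iff)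
    then have "(cmod (h z - of_real a))\<^sup>2 < (cmod (1 - of_real a * h z))\<^sup>2"
      using id[of "h z"] by linarith
    then have "cmod (h z - of_real a) < cmod (1 - of_real a * h z)"
      by (rule power_less_imp_less_base) simp
    then show ?thesis
      using nz[OF that] by (simp add: g_def norm_divide)
  qed
  ultimately have "cmod (g z) \<le> cmod z"
    using Schwarz_Lemma(1) z by blast
  then have le: "cmod (h z - of_real a) \<le> cmod z * cmod (1 - of_real a * h z)"
    using nz[OF z] by (simp add: g_def norm_divide field_simps)
  define r u v where "r = cmod z" and "u = Re (h z)" and "v = Im (h z)"
  have r: "0 \<le> r" "r < 1"
    using z by (auto simp: r_def)
  have "(cmod (h z - of_real a))\<^sup>2 \<le> (r * cmod (1 - of_real a * h z))\<^sup>2"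
    using le unfolding r_def by (rule power_mono) simp
  then have sq: "(u - a)\<^sup>2 + v\<^sup>2 \<le> r\<^sup>2 * ((1 - a * u)\<^sup>2 + (a * v)\<^sup>2)"
    unfolding power_mult_distrib[of r] cmod_power2 by (simp add: u_def v_def)
  have "(r * a)\<^sup>2 \<le> 1"
    using r a by (simp add: abs_square_le_1 abs_mult mult_le_one)
  then have "(r * a)\<^sup>2 * v\<^sup>2 \<le> v\<^sup>2"
    by (simp add: mult_left_le_one_le)
  moreover have "r\<^sup>2 * ((1 - a * u)\<^sup>2 + (a * v)\<^sup>2) = (r * (1 - a * u))\<^sup>2 + (r * a)\<^sup>2 * v\<^sup>2"
    by (simp add: power_mult_distrib distrib_left mult_ac)
  ultimately have "(a - u)\<^sup>2 \<le> (r * (1 - a * u))\<^sup>2"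
    using sq power2_commute[of a u] by linarith
  \<comment> \<open>This makes \<open>r * (1 - a * u)\<close> nonnegative, so the inequality of
    squares yields one without squares.\<close>
  moreover have "a * u \<le> 1"
    using ah[OF z] complex_Re_le_cmod[of "of_real a * h z"] by (simp add: u_def)
  ultimately have "a - u \<le> r * (1 - a * u)"
    using r by (auto intro: power2_le_imp_le[OF _ mult_nonneg_nonneg])
  then have "a - r \<le> u * (1 - a * r)"
    by (simp add: algebra_simps)
  moreover have "a * r < 1"
    using mult_strict_mono'[OF a r(2)] r by (simp add: abs_less_iff) (smt (verit) abs_ge_self mult_right_mono)
  ultimately show ?thesis
    unfolding r_def u_def by (simp add: divide_le_eq)
qed

text \<open>A quantitative form of the Noshiro-Warschawski argument: the real part of the difference
  quotient equals the real part of \<open>f'\<close> at some point of the segment.\<close>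

lemma norm_diff_ge_of_Re_deriv_ge:
  assumes "convex S" and d: "\<And>z. z \<in> S \<Longrightarrow> (f has_field_derivative f' z) (at z)"
    and p: "\<And>z. z \<in> S \<Longrightarrow> p \<le> Re (f' z)" and "w \<in> S" "z \<in> S"
  shows "p * cmod (w - z) \<le> cmod (f w - f z)"
proof (cases "w = z")
  case False
  have seg: "closed_segment z w \<subseteq> S"
    using assms by (simp add: closed_segment_subset)
  \<comment> \<open>The mean value theorem is applied to \<open>f\<close> divided by the constant
    \<open>w - z\<close>, so that the increment cancels and leaves \<open>f' u\<close>.\<close>
  then have "\<exists>u. u \<in> closed_segment z w \<and>
      Re (f w / (w - z)) - Re (f z / (w - z)) = Re (f' u / (w - z) * (w - z))"
    by (intro complex_mvt_line DERIV_cdivide d) auto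
  then obtain u where u: "u \<in> S" "Re ((f w - f z) / (w - z)) = Re (f' u)"
    using False seg by (auto simp: diff_divide_distrib)
  then have "p \<le> cmod ((f w - f z) / (w - z))"
    using p[of u] complex_Re_le_cmod[of "(f w - f z) / (w - z)"] by simp
  then show ?thesis
    using False by (simp add: norm_divide field_simps)
qed simp

lemma real_power_diff_le:
  fixes x y s :: real
  assumes "0 \<le> x" "x \<le> s" "0 \<le> y" "y \<le> s"
  shows "\<bar>x ^ n - y ^ n\<bar> \<le> real n * s ^ (n - 1) * \<bar>x - y\<bar>"
proof -
  have "cmod (of_real x ^ n - of_real y ^ n) \<le> (real n * s ^ (n - 1)) * cmod (of_real x - of_real y)"
  proof (rule field_differentiable_bound[where S = "cball 0 s" and f = "\<lambda>z. z ^ n"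
        and f' = "\<lambda>z. of_nat n * z ^ (n - 1)"])
    show "((\<lambda>z. z ^ n) has_field_derivative of_nat n * z ^ (n - 1)) (at z within cball 0 s)"
      for z :: complex
      by (auto intro!: derivative_eq_intros)
    show "cmod (of_nat n * z ^ (n - 1)) \<le> real n * s ^ (n - 1)" if "z \<in> cball 0 s" for z
      using that by (auto simp: norm_mult norm_power intro!: mult_left_mono power_mono)
  qed (use assms in auto)
  then show ?thesis
    by (metis norm_of_real of_real_diff of_real_power)
qed

section \<open>The Wirtinger derivative at the origin\<close>

lemma wirtinger_z_field_derivative:
  assumes "(F has_field_derivative d) (at z)"
  shows "wirtinger_z F z = d"
proof -
  have d: "(F has_field_derivative d) (at (z + c * of_real 0))" for c
    using assms by simp
  have "((\<lambda>t. z + c * complex_of_real t) has_vector_derivative c) (at 0)" for c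
    by (auto intro!: derivative_eq_intros)
  from field_vector_diff_chain_at[OF this d]
  have "((\<lambda>t. F (z + c * complex_of_real t)) has_vector_derivative (c * d)) (at 0)" for c
    by (simp add: o_def)
  from vector_derivative_at[OF this]
  have v: "vector_derivative (\<lambda>t. F (z + c * complex_of_real t)) (at 0) = c * d" for c .
  \<comment> \<open>The partial derivatives are \<open>d\<close> and \<open>\<i> * d\<close>, and
    \<open>- \<i> * \<i> = 1\<close>.\<close>
  show ?thesis
    using v[of 1] v[of \<i>] by (simp add: wirtinger_z_def)
qed

text \<open>At the origin \<open>F\<close> is complex differentiable: for \<open>k > 0\<close> the
  difference quotient of a term is \<open>f k z / z\<close>, which converges, times a power of
  \<open>cmod z\<close> tending to 0. This translates the normalization of \<open>F\<close> into
  \<open>deriv (f 0) 0 = 1\<close>.\<close>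

lemma reduced_poly_analytic_derivative_zero:
  assumes "reduced_poly_analytic m (ball 0 1) f F" "m \<ge> 1" "\<forall>k<m. f k 0 = 0"
  shows "(F has_field_derivative deriv (f 0) 0) (at 0)"
proof -
  have hol: "f k holomorphic_on ball 0 1" if "k < m" for k
    using assms that by (simp add: reduced_poly_analytic_def)
  have "((\<lambda>z. of_real (cmod z ^ (2 * k)) * f k z) has_field_derivative
      (if k = 0 then deriv (f 0) 0 else 0)) (at 0)" if "k < m" for k
  proof -
    have D: "(f k has_field_derivative deriv (f k) 0) (at 0)"
      using hol[OF that] by (intro holomorphic_derivI[where S = "ball 0 1"]) auto
    show ?thesis
    proof (cases "k = 0")
      case True then show ?thesis using D by simp
    next
      case False
      have "((\<lambda>z. f k z / z) \<longlongrightarrow> deriv (f k) 0) (at 0)"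
        using D assms(3) that by (simp add: has_field_derivative_iff)
      moreover have "isCont (\<lambda>z. complex_of_real (cmod z ^ (2 * k))) 0"
        by (intro continuous_intros)
      then have "((\<lambda>z. complex_of_real (cmod z ^ (2 * k))) \<longlongrightarrow> 0) (at 0)"
        using False by (simp add: isCont_def power_0_left)
      ultimately have "((\<lambda>z. of_real (cmod z ^ (2 * k)) * (f k z / z)) \<longlongrightarrow> 0 * deriv (f k) 0) (at 0)"
        by (intro tendsto_mult)
      then show ?thesis
        using False assms(3) that by (simp add: has_field_derivative_iff)
    qed
  qed
  then have "((\<lambda>z. \<Sum>k<m. of_real (cmod z ^ (2 * k)) * f k z) has_field_derivative
      (\<Sum>k<m. if k = 0 then deriv (f 0) 0 else 0)) (at 0)"
    by (intro DERIV_sum) auto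
  moreover have "(\<Sum>k<m. if k = 0 then deriv (f 0) 0 else 0) = deriv (f 0) 0"
    using assms(2) by (subst sum.delta) auto
  ultimately have "((\<lambda>z. \<Sum>k<m. of_real (cmod z ^ (2 * k)) * f k z) has_field_derivative
      deriv (f 0) 0) (at 0)"
    by simp
  then show ?thesis
    by (rule has_field_derivative_transform_within_open[where S = "ball 0 1"])
      (use assms(1) in \<open>auto simp: reduced_poly_analytic_def\<close>)
qed

section \<open>Estimates for a map \<open>F\<close> satisfying the hypotheses\<close>

context
  fixes m :: nat and M :: "nat \<Rightarrow> real" and f :: "nat \<Rightarrow> complex \<Rightarrow> complex"
    and F :: "complex \<Rightarrow> complex"
  assumes m: "m \<ge> 1" and M_nonneg: "\<forall>k\<in>{1..<m}. M k \<ge> 0"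
    and hyp: "bloch_hypotheses m M f F"
begin

lemma f_hol: "k < m \<Longrightarrow> f k holomorphic_on ball 0 1"
  using hyp by (simp add: bloch_hypotheses_def reduced_poly_analytic_def)

lemma f_deriv: "k < m \<Longrightarrow> cmod z < 1 \<Longrightarrow> (f k has_field_derivative deriv (f k) z) (at z)"
  using holomorphic_derivI[OF f_hol, of k z] by simp

lemma f_zero: "k < m \<Longrightarrow> f k 0 = 0"
  using hyp by (simp add: bloch_hypotheses_def)

lemma deriv_f0: "deriv (f 0) 0 = 1"
  using hyp m wirtinger_z_field_derivative[OF reduced_poly_analytic_derivative_zero, of m f F]
  by (simp add: bloch_hypotheses_def)

lemma M0_gt_1: "M 0 > 1"
proof -
  have "cmod (deriv (f 0) 0) < M 0"
    using hyp by (simp add: bloch_hypotheses_def)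
  then show ?thesis
    by (simp add: deriv_f0)
qed

lemma F_split:
  assumes "cmod z < 1"
  shows "F z = f 0 z + (\<Sum>k\<in>{1..<m}. of_real (cmod z ^ (2 * k)) * f k z)"
proof -
  have "F z = (\<Sum>k<m. of_real (cmod z ^ (2 * k)) * f k z)"
    using hyp assms by (simp add: bloch_hypotheses_def reduced_poly_analytic_def)
  also have "{..<m} = insert 0 {1..<m}"
    using m by auto
  finally show ?thesis by simp
qed

lemma F_continuous_on: "continuous_on (ball 0 1) F"
proof -
  have "continuous_on (ball 0 1) (\<lambda>z. \<Sum>k<m. of_real (cmod z ^ (2 * k)) * f k z)"
    using f_hol by (intro continuous_intros) (auto intro: holomorphic_on_imp_continuous_on)
  then show ?thesis
    using hyp by (subst continuous_on_cong[OF refl])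
      (auto simp: bloch_hypotheses_def reduced_poly_analytic_def)
qed

text \<open>\<open>Schwarz_Pick_Re\<close> for \<open>deriv (f 0)\<close> divided by
  \<open>M 0\<close>, whose value at 0 is \<open>1 / M 0\<close>.\<close>

lemma Re_deriv_f0:
  assumes "cmod z < 1"
  shows "Re (deriv (f 0) z) \<ge> M 0 * ((1 - M 0 * cmod z) / (M 0 - cmod z))"
proof -
  let ?h = "\<lambda>z. deriv (f 0) z / of_real (M 0)"
  have "?h holomorphic_on ball 0 1"
    using f_hol[of 0] m M0_gt_1 by (intro holomorphic_intros) auto
  moreover have "cmod (?h z) < 1" if "cmod z < 1" for z
    using hyp M0_gt_1 that by (simp add: bloch_hypotheses_def norm_divide)
  ultimately have "Re (?h z) \<ge> (1 / M 0 - cmod z) / (1 - 1 / M 0 * cmod z)"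
    using assms by (intro Schwarz_Pick_Re) (auto simp: deriv_f0)
  moreover have "(1 / M 0 - cmod z) / (1 - 1 / M 0 * cmod z) = (1 - M 0 * cmod z) / (M 0 - cmod z)"
    using M0_gt_1 assms by (simp add: field_simps)
  ultimately have "(1 - M 0 * cmod z) / (M 0 - cmod z) \<le> Re (deriv (f 0) z) / M 0"
    by simp
  then have "(1 - M 0 * cmod z) / (M 0 - cmod z) * M 0 \<le> Re (deriv (f 0) z)"
    using M0_gt_1 by (intro pos_le_divide_eq[THEN iffD1]) auto
  then show ?thesis
    by (simp only: mult.commute)
qed

lemma f_lipschitz:
  assumes "k \<in> {1..<m}" "cmod z < 1" "cmod w < 1"
  shows "cmod (f k z - f k w) \<le> M k * cmod (z - w)"
proof (rule field_differentiable_bound[where S = "ball 0 1" and f' = "deriv (f k)"])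
  show "cmod (deriv (f k) x) \<le> M k" if "x \<in> ball 0 1" for x
    using hyp assms that by (simp add: bloch_hypotheses_def)
qed (use assms f_deriv in \<open>auto intro: has_field_derivative_at_within\<close>)

lemma f_bound:
  assumes "k \<in> {1..<m}" "cmod z < 1"
  shows "cmod (f k z) \<le> M k * cmod z"
  using f_lipschitz[of k z 0] f_zero[of k] assms by simp

text \<open>A product estimate: varying \<open>f k\<close> costs \<open>M k * s ^ (2 * k)\<close>,
  and varying the power of the modulus costs \<open>2 * k\<close> times as much, since
  \<open>f k\<close> is at most \<open>M k * s\<close>.\<close>

lemma term_lipschitz:
  assumes k: "k \<in> {1..<m}" and "cmod z \<le> s" "cmod w \<le> s" "s < 1"
  shows "cmod (of_real (cmod z ^ (2 * k)) * f k z - of_real (cmod w ^ (2 * k)) * f k w)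
    \<le> M k * real (2 * k + 1) * s ^ (2 * k) * cmod (z - w)"
proof -
  have s: "s \<ge> 0" and lt: "cmod z < 1" "cmod w < 1" and Mk: "M k \<ge> 0"
    using assms M_nonneg norm_ge_zero[of z] by (auto simp del: norm_ge_zero)
  have "of_real (cmod z ^ (2 * k)) * f k z - of_real (cmod w ^ (2 * k)) * f k w
      = of_real (cmod z ^ (2 * k)) * (f k z - f k w)
        + of_real (cmod z ^ (2 * k) - cmod w ^ (2 * k)) * f k w"
    by (simp add: algebra_simps)
  also have "cmod \<dots> \<le> cmod z ^ (2 * k) * cmod (f k z - f k w)
      + \<bar>cmod z ^ (2 * k) - cmod w ^ (2 * k)\<bar> * cmod (f k w)"
    by (rule norm_triangle_le) (simp add: norm_mult norm_power del: of_real_power of_real_diff)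
  also have "\<dots> \<le> s ^ (2 * k) * (M k * cmod (z - w))
      + (real (2 * k) * s ^ (2 * k - 1) * cmod (z - w)) * (M k * s)"
  proof (intro add_mono mult_mono)
    show "\<bar>cmod z ^ (2 * k) - cmod w ^ (2 * k)\<bar> \<le> real (2 * k) * s ^ (2 * k - 1) * cmod (z - w)"
      using real_power_diff_le[of "cmod z" s "cmod w" "2 * k"] assms norm_triangle_ineq3[of z w]
      by (intro order_trans[OF _ mult_left_mono[of "\<bar>cmod z - cmod w\<bar>" "cmod (z - w)"
              "real (2 * k) * s ^ (2 * k - 1)"]]) (use s in auto)
    show "cmod (f k w) \<le> M k * s"
      using f_bound[OF k lt(2)] mult_left_mono[OF assms(3) Mk] by linarith
  qed (use assms s lt Mk f_lipschitz in \<open>auto intro: power_mono\<close>)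
  also have "\<dots> = M k * real (2 * k + 1) * s ^ (2 * k) * cmod (z - w)"
    using k power_minus_mult[of "2 * k" s] by (simp add: algebra_simps)
  finally show ?thesis .
qed

text \<open>The expansion of \<open>f 0\<close> minus the Lipschitz constants of the other terms is
  exactly \<open>phi m M s\<close>.\<close>

lemma F_diff_ge:
  assumes "cmod z \<le> s" "cmod w \<le> s" "s < 1"
  shows "phi m M s * cmod (z - w) \<le> cmod (F z - F w)"
proof -
  let ?t = "\<lambda>k z. of_real (cmod z ^ (2 * k)) * f k z"
  have lt: "cmod z < 1" "cmod w < 1"
    using assms by auto
  have "M 0 * ((1 - M 0 * s) / (M 0 - s)) * cmod (z - w) \<le> cmod (f 0 z - f 0 w)"
  proof (rule norm_diff_ge_of_Re_deriv_ge[where S = "cball 0 s" and f' = "deriv (f 0)"])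
    fix x :: complex assume x: "x \<in> cball 0 s"
    \<comment> \<open>The bound decreases in the modulus, so its value at \<open>s\<close> serves on
      the whole closed disk.\<close>
    have "M 0 * ((1 - M 0 * s) / (M 0 - s)) \<le> M 0 * ((1 - M 0 * cmod x) / (M 0 - cmod x))"
      using x assms M0_gt_1 moebius_antimono[of "M 0" "cmod x" s] by (cases "cmod x = s") auto
    also have "\<dots> \<le> Re (deriv (f 0) x)"
      using x assms by (intro Re_deriv_f0) auto
    finally show "M 0 * ((1 - M 0 * s) / (M 0 - s)) \<le> Re (deriv (f 0) x)" .
    show "(f 0 has_field_derivative deriv (f 0) x) (at x)"
      using x assms m by (intro f_deriv) auto
  qed (use assms in auto)
  moreover have "cmod (\<Sum>k\<in>{1..<m}. ?t k z - ?t k w)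
      \<le> (\<Sum>k\<in>{1..<m}. M k * real (2 * k + 1) * s ^ (2 * k) * cmod (z - w))"
    using assms by (intro sum_norm_le term_lipschitz)
  moreover have "F z - F w = (f 0 z - f 0 w) + (\<Sum>k\<in>{1..<m}. ?t k z - ?t k w)"
    using lt by (simp add: F_split sum_subtractf)
  moreover have "cmod (f 0 z - f 0 w) - cmod (\<Sum>k\<in>{1..<m}. ?t k z - ?t k w)
      \<le> cmod ((f 0 z - f 0 w) + (\<Sum>k\<in>{1..<m}. ?t k z - ?t k w))"
    by (rule norm_diff_ineq)
  ultimately show ?thesis
    by (simp add: phi_def left_diff_distrib sum_distrib_right)
qed

section \<open>Univalence and the schlicht disk\<close>

lemma F_inj_on:
  assumes "is_r5 m M r"
  shows "inj_on F (ball 0 r)"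
proof (rule inj_onI, rule ccontr)
  fix z w assume zw: "z \<in> ball 0 r" "w \<in> ball 0 r" "F z = F w" "z \<noteq> w"
  define s where "s = max (cmod z) (cmod w)"
  have s: "cmod z \<le> s" "cmod w \<le> s" "0 \<le> s" "s < r" "r < 1"
    using zw assms by (auto simp: s_def is_r5_iff le_max_iff_disj)
  then have "0 < phi m M s"
    using phi_strict_decreasing[OF M0_gt_1 M_nonneg, of s r] assms by (auto simp: is_r5_iff)
  then have "0 < phi m M s * cmod (z - w)"
    using zw by simp
  then show False
    using F_diff_ge[of z s w] s zw by simp
qed

text \<open>Along the ray through \<open>z\<close>, the component of \<open>f 0\<close> in the
  direction of \<open>z\<close> grows at least as fast as the right-hand side, by
  \<open>Re_deriv_f0\<close>.\<close>

lemma f0_lower: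
  assumes "cmod z < 1"
  shows "cmod (f 0 z) \<ge> (M 0)\<^sup>2 * cmod z + ((M 0) ^ 3 - M 0) * ln (1 - cmod z / M 0)"
proof (cases "z = 0")
  case False
  \<comment> \<open>For \<open>m = 1\<close> the sums are empty: \<open>L\<close> is the part of
    \<open>r6\<close> belonging to \<open>f 0\<close>, with derivative
    \<open>phi 1 M\<close>.\<close>
  define L where "L = r6 1 M"
  define u where "u = z / of_real (cmod z)"
  have u: "cmod u = 1" "z = of_real (cmod z) * u"
    using False by (auto simp: u_def norm_divide)
  have "cnj u * u = 1"
    using u(1) complex_norm_square[of u] by (simp add: mult.commute)
  have deriv: "((\<lambda>t. Re (cnj u * f 0 (of_real t * u)) - L t) has_real_derivative
      Re (deriv (f 0) (of_real t * u)) - phi 1 M t) (at t)" if "0 \<le> t" "t < 1" for t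
  proof -
    have "((\<lambda>t. of_real t * u) has_vector_derivative u) (at t)"
      by (auto intro!: derivative_eq_intros)
    moreover have "(f 0 has_field_derivative deriv (f 0) (of_real t * u)) (at (of_real t * u))"
      using m that u by (intro f_deriv) (auto simp: norm_mult)
    ultimately have "((f 0 \<circ> (\<lambda>t. of_real t * u)) has_vector_derivative
        u * deriv (f 0) (of_real t * u)) (at t)"
      by (rule field_vector_diff_chain_at)
    then have "((\<lambda>t. cnj u * (f 0 \<circ> (\<lambda>t. of_real t * u)) t) has_vector_derivative
        cnj u * (u * deriv (f 0) (of_real t * u))) (at t)"
      by (rule has_vector_derivative_mult_right)
    then have "((\<lambda>t. Re (cnj u * f 0 (of_real t * u))) has_vector_derivative
        Re (cnj u * (u * deriv (f 0) (of_real t * u)))) (at t)"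
      by (intro bounded_linear.has_vector_derivative[OF bounded_linear_Re]) (simp add: o_def)
    then have "((\<lambda>t. Re (cnj u * f 0 (of_real t * u))) has_real_derivative
        Re (deriv (f 0) (of_real t * u))) (at t)"
      by (simp add: has_real_derivative_iff_has_vector_derivative mult.assoc[symmetric]
          \<open>cnj u * u = 1\<close> del: times_complex.sel)
    then show ?thesis
      unfolding L_def using M0_gt_1 that by (intro DERIV_diff r6_has_derivative) auto
  qed
  have "Re (cnj u * f 0 (of_real 0 * u)) - L 0
      \<le> Re (cnj u * f 0 (of_real (cmod z) * u)) - L (cmod z)"
  proof (rule DERIV_nonneg_imp_nondecreasing[of 0 "cmod z"
        "\<lambda>t. Re (cnj u * f 0 (of_real t * u)) - L t"])
    fix t assume t: "0 \<le> t" "t \<le> cmod z"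
    have "phi 1 M t \<le> Re (deriv (f 0) (of_real t * u))"
      using Re_deriv_f0[of "of_real t * u"] t assms u(1) by (simp add: phi_def norm_mult)
    then show "\<exists>d. ((\<lambda>t. Re (cnj u * f 0 (of_real t * u)) - L t) has_real_derivative d) (at t)
        \<and> 0 \<le> d"
      using deriv[of t] t assms by (intro exI[of _ "Re (deriv (f 0) (of_real t * u)) - phi 1 M t"]) auto
  qed simp
  then have "L (cmod z) \<le> Re (cnj u * f 0 z)"
    using f_zero[of 0] m u(2) by (simp add: L_def r6_zero del: times_complex.sel)
  also have "\<dots> \<le> cmod (cnj u * f 0 z)"
    by (rule complex_Re_le_cmod)
  also have "\<dots> = cmod (f 0 z)"
    by (simp add: norm_mult u(1))
  finally show ?thesis
    by (simp add: L_def r6_def)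
qed simp

lemma F_lower:
  assumes "cmod z < 1"
  shows "r6 m M (cmod z) \<le> cmod (F z)"
proof -
  have "cmod (\<Sum>k\<in>{1..<m}. of_real (cmod z ^ (2 * k)) * f k z)
      \<le> (\<Sum>k\<in>{1..<m}. M k * cmod z ^ (2 * k + 1))"
  proof (rule sum_norm_le)
    fix k assume k: "k \<in> {1..<m}"
    have "cmod z ^ (2 * k) * cmod (f k z) \<le> cmod z ^ (2 * k) * (M k * cmod z)"
      using f_bound[OF k assms] by (intro mult_left_mono) auto
    then show "cmod (of_real (cmod z ^ (2 * k)) * f k z) \<le> M k * cmod z ^ (2 * k + 1)"
      by (simp add: norm_mult norm_power mult_ac)
  qed
  moreover have "cmod (f 0 z) - cmod (\<Sum>k\<in>{1..<m}. of_real (cmod z ^ (2 * k)) * f k z) \<le> cmod (F z)"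
    unfolding F_split[OF assms] by (rule norm_diff_ineq)
  ultimately show ?thesis
    using f0_lower[OF assms] by (simp add: r6_def)
qed

lemma F_zero: "F 0 = 0"
  using F_split[of 0] f_zero m by simp

text \<open>The part of the image lying in the target disk is open by invariance of domain and
  closed by compactness of the closed disk, hence everything by connectedness.\<close>

lemma F_schlicht:
  assumes r: "is_r5 m M r"
  shows "contains_schlicht_disk F (ball 0 r) 0 (r6 m M r)"
proof -
  define R where "R = r6 m M r"
  have r01: "0 < r" "r < 1"
    using r by (auto simp: is_r5_iff)
  have R: "R > 0"
    using r6_increasing[OF M0_gt_1 M_nonneg r, of 0] r01 by (simp add: R_def r6_zero)
  have cont_c: "continuous_on (cball 0 r) F"
    using r01 by (intro continuous_on_subset[OF F_continuous_on]) auto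
  then have cont: "continuous_on (ball 0 r) F"
    by (rule continuous_on_subset) auto
  have inj: "inj_on F (ball 0 r)"
    using F_inj_on[OF r] .
  have "open (F ` ball 0 r)"
    by (rule invariance_of_domain[OF cont open_ball inj])
  \<comment> \<open>By \<open>F_lower\<close> the boundary circle is mapped outside the open target
    disk, so open and closed disk have the same trace there.\<close>
  have eq: "ball 0 R \<inter> F ` cball 0 r = ball 0 R \<inter> F ` ball 0 r"
  proof -
    have "cmod z \<noteq> r" if "cmod (F z) < R" for z
      using F_lower[of z] r01 that by (auto simp: R_def)
    then show ?thesis by (force simp: less_le)
  qed
  have "closed (F ` cball 0 r)"
    by (intro compact_imp_closed compact_continuous_image cont_c compact_cball)
  then have "closedin (top_of_set (ball 0 R)) (ball 0 R \<inter> F ` ball 0 r)"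
    unfolding eq[symmetric] by (rule closedin_closed_Int)
  moreover have "openin (top_of_set (ball 0 R)) (ball 0 R \<inter> F ` ball 0 r)"
    using \<open>open (F ` ball 0 r)\<close> by (rule openin_open_Int)
  moreover have "0 \<in> ball 0 R \<inter> F ` ball 0 r"
    using R r01 F_zero by (auto intro!: image_eqI[of _ _ 0])
  ultimately have "ball 0 R \<inter> F ` ball 0 r = ball 0 R"
    using connected_ball[of "0 :: complex" R] unfolding connected_clopen by blast
  then have sub: "ball 0 R \<subseteq> F ` ball 0 r"
    by blast
  obtain g where g: "homeomorphism (ball 0 r) (F ` ball 0 r) F g"
    using invariance_of_domain_homeomorphism[OF open_ball cont _ inj] by auto
  \<comment> \<open>Both descriptions of \<open>U\<close> are used: as an image under the continuous
    inverse it is connected, as a preimage under \<open>F\<close> it is open.\<close>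
  define U where "U = g ` ball 0 R"
  have U: "U = ball 0 r \<inter> F -` ball 0 R"
    using g sub unfolding U_def homeomorphism_def by force
  have "connected U"
    unfolding U_def using g sub
    by (intro connected_continuous_image connected_ball)
      (auto simp: homeomorphism_def intro: continuous_on_subset)
  moreover have "open U"
    unfolding U by (intro continuous_open_preimage cont open_ball)
  moreover have "F ` U = ball 0 R"
    using sub unfolding U by blast
  moreover have "inj_on F U"
    using inj U by (auto intro: inj_on_subset)
  ultimately show ?thesis
    using R U unfolding contains_schlicht_disk_def R_def by blast
qed

end

section \<open>Sharpness: the extremal function \<open>G4\<close>\<close>

lemma G4_of_real:
  assumes "M 0 > 1" "x < M 0" "0 \<le> x"
  shows "G4 m M (of_real x) = of_real (r6 m M x)"
proof -
  have "1 - complex_of_real x / of_real (M 0) = of_real (1 - x / M 0)"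
    by simp
  moreover have "1 - x / M 0 > 0"
    using assms by simp
  ultimately have "Ln (1 - complex_of_real x / of_real (M 0)) = of_real (ln (1 - x / M 0))"
    using Ln_of_real by metis
  then show ?thesis
    using assms by (simp add: G4_def r6_def mult_ac)
qed

text \<open>The components are \<open>f0\<close> and the linear maps \<open>- M k * z\<close>. The
  derivative of \<open>f0\<close> is \<open>a\<close> times a disk automorphism, whence the strict
  bound, and equals 1 at 0.\<close>

lemma bloch_hypotheses_G4:
  assumes "m \<ge> 1" "\<forall>k\<in>{1..<m}. M k \<ge> 0" and M0: "M 0 > 1"
  shows "\<exists>g. bloch_hypotheses m M g (G4 m M)"
proof -
  define a where "a = M 0"
  have a: "a > 1" using M0 by (simp add: a_def)
  define f0 where "f0 = (\<lambda>z. of_real (a\<^sup>2) * z + of_real (a ^ 3 - a) * Ln (1 - z / of_real a))"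
  define f where "f = (\<lambda>k z. if k = 0 then f0 z else - of_real (M k) * z)"
  have f_simps: "f 0 = f0" "\<And>k. k \<noteq> 0 \<Longrightarrow> f k = (\<lambda>z. - of_real (M k) * z)"
    by (auto simp: f_def)
  have D0: "(f0 has_field_derivative of_real a * (1 - of_real a * z) / (of_real a - z)) (at z)"
    if "cmod z < 1" for z
  proof -
    have ne: "of_real a \<noteq> z" "complex_of_real a \<noteq> 0"
      using that a by auto
    \<comment> \<open>This keeps the argument of \<open>Ln\<close> in the right half-plane, off the
      branch cut.\<close>
    have "Re z < a"
      using that a complex_Re_le_cmod[of z] by linarith
    then have "Re (1 - z / of_real a) > 0"
      using a by simp
    then have "1 - z / of_real a \<notin> \<real>\<^sub>\<le>\<^sub>0"
      by (auto simp: complex_nonpos_Reals_iff)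
    then have "((\<lambda>z. Ln (1 - z / of_real a)) has_field_derivative
        inverse (1 - z / of_real a) * (- 1 / of_real a)) (at z)"
      using ne by (intro DERIV_chain2[OF has_field_derivative_Ln]) (auto intro!: derivative_eq_intros)
    then have "(f0 has_field_derivative of_real (a\<^sup>2) * 1
        + of_real (a ^ 3 - a) * (inverse (1 - z / of_real a) * (- 1 / of_real a))) (at z)"
      unfolding f0_def by (intro DERIV_add DERIV_cmult DERIV_ident)
    moreover have "of_real (a\<^sup>2) * 1
        + of_real (a ^ 3 - a) * (inverse (1 - z / of_real a) * (- 1 / of_real a))
      = of_real a * (1 - of_real a * z) / (of_real a - z)"
      using ne by (simp add: field_simps power2_eq_square power3_eq_cube)
    ultimately show ?thesis
      by simp
  qed
  have bound0: "cmod (of_real a * (1 - of_real a * z) / (of_real a - z)) < a" if "cmod z < 1" for z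
  proof -
    have "(cmod (of_real a - z))\<^sup>2 - (cmod (1 - of_real a * z))\<^sup>2 = (a\<^sup>2 - 1) * (1 - (cmod z)\<^sup>2)"
      unfolding cmod_power2 by (simp add: algebra_simps power2_eq_square)
    moreover have "(a\<^sup>2 - 1) * (1 - (cmod z)\<^sup>2) > 0"
      using a that by (intro mult_pos_pos) (auto simp: power_less_one_iff)
    ultimately have "(cmod (1 - of_real a * z))\<^sup>2 < (cmod (of_real a - z))\<^sup>2"
      by linarith
    then have "cmod (1 - of_real a * z) < cmod (of_real a - z)"
      by (rule power_less_imp_less_base) simp
    then have "cmod (1 - of_real a * z) / cmod (of_real a - z) < 1"
      by (smt (verit) divide_less_eq_1 norm_ge_zero)
    then show ?thesis
      using a mult_strict_left_mono[of "cmod (1 - of_real a * z) / cmod (of_real a - z)" 1 a]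
      by (simp add: norm_mult norm_divide)
  qed
  have "f0 holomorphic_on ball 0 1"
    using D0 by (subst holomorphic_on_open) (auto intro!: exI D0)
  then have hol: "f k holomorphic_on ball 0 1" for k
    by (cases "k = 0") (auto simp: f_simps intro!: holomorphic_intros)
  have "{..<m} = insert 0 {1..<m}"
    using assms(1) by auto
  moreover have "f k = (\<lambda>z. - of_real (M k) * z)" if "k \<in> {1..<m}" for k
    using that f_simps by simp
  ultimately have G4_sum: "G4 m M z = (\<Sum>k<m. of_real (cmod z ^ (2 * k)) * f k z)" for z
    by (simp add: f_simps G4_def f0_def a_def sum_negf mult_ac)
  have rpa: "reduced_poly_analytic m (ball 0 1) f (G4 m M)"
    unfolding reduced_poly_analytic_def using hol G4_sum by blast
  have zero: "\<forall>k<m. f k 0 = 0"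
    by (simp add: f_def f0_def)
  have "deriv (f 0) 0 = 1"
    using DERIV_imp_deriv[OF D0[of 0]] a by (simp add: f_simps)
  then have "wirtinger_z (G4 m M) 0 = 1"
    using wirtinger_z_field_derivative[OF reduced_poly_analytic_derivative_zero[OF rpa assms(1) zero]]
    by simp
  moreover have "cmod (deriv (f 0) z) < M 0" if "z \<in> ball 0 1" for z
    using DERIV_imp_deriv[OF D0[of z]] bound0[of z] that by (simp add: f_simps a_def)
  moreover have "cmod (deriv (f k) z) \<le> M k" if "k \<in> {1..<m}" for k z
  proof -
    have "(f k has_field_derivative - of_real (M k)) (at z)"
      using that by (auto simp: f_simps intro!: derivative_eq_intros)
    then show ?thesis
      using that assms(2) by (simp add: DERIV_imp_deriv)
  qed
  ultimately have "bloch_hypotheses m M f (G4 m M)"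
    using rpa zero M0 by (auto simp: bloch_hypotheses_def)
  then show ?thesis
    by blast
qed

text \<open>Injectivity would pass to \<open>r6\<close> along the real axis, but a continuous
  injective function on an interval is strictly monotone, whereas \<open>r6\<close> turns around at
  \<open>r\<close>.\<close>

lemma G4_not_inj_on:
  assumes M: "M 0 > 1" "\<forall>k\<in>{1..<m}. M k \<ge> 0" "is_r5 m M r" and r': "r < r'" "r' \<le> 1"
  shows "\<not> inj_on (G4 m M) (ball 0 r')"
proof
  assume inj: "inj_on (G4 m M) (ball 0 r')"
  define x where "x = (r + r') / 2"
  have x: "0 < r" "r < x" "x < r'" "x \<le> 1"
    using assms by (auto simp: x_def is_r5_iff)
  have "inj_on (r6 m M) {0..x}"
  proof (rule inj_onI)
    fix s t assume st: "s \<in> {0..x}" "t \<in> {0..x}" "r6 m M s = r6 m M t"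
    then have "G4 m M (of_real s) = G4 m M (of_real t)"
      using x M by (simp add: G4_of_real)
    then have "complex_of_real s = of_real t"
      by (rule inj_onD[OF inj]) (use st x in auto)
    then show "s = t" by simp
  qed
  moreover have "continuous_on {0..x} (r6 m M)"
    using x M by (intro continuous_on_subset[OF r6_continuous_on]) auto
  ultimately have "(r6 m M 0 < r6 m M r \<and> r6 m M r < r6 m M x) \<or>
      (r6 m M x < r6 m M r \<and> r6 m M r < r6 m M 0)"
    using x by (intro continuous_inj_imp_mono) auto
  then show False
    using r6_decreasing[of M m r x] r6_increasing[of M m r 0] M x by auto
qed

text \<open>Were \<open>r6\<close> an interior value \<open>G4 z\<close>, a small disk around \<open>z\<close> would already cover the values
  at real points near \<open>r\<close>, against injectivity.\<close>

lemma G4_omits_r6: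
  assumes "m \<ge> 1" and M: "M 0 > 1" "\<forall>k\<in>{1..<m}. M k \<ge> 0" "is_r5 m M r"
  shows "of_real (r6 m M r) \<notin> G4 m M ` ball 0 r"
proof
  assume "of_real (r6 m M r) \<in> G4 m M ` ball 0 r"
  then obtain z where z: "cmod z < r" "G4 m M z = of_real (r6 m M r)"
    by auto
  obtain g where hyp: "bloch_hypotheses m M g (G4 m M)"
    using bloch_hypotheses_G4 assms by blast
  have r: "0 < r" "r < 1"
    using M by (auto simp: is_r5_iff)
  have inj: "inj_on (G4 m M) (ball 0 r)"
    using F_inj_on[OF assms(1) M(2) hyp M(3)] .
  \<comment> \<open>The midpoint separates \<open>z\<close> from the real points in
    \<open>{s<..<r}\<close>, so the two preimages found below must differ.\<close>
  define s where "s = (cmod z + r) / 2"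
  have s: "cmod z < s" "s < r" "0 < s"
    using z r norm_ge_zero[of z] by (simp_all add: s_def del: norm_ge_zero)
  have "open (G4 m M ` ball 0 s)"
    using s r F_continuous_on[OF assms(1) M(2) hyp]
    by (intro invariance_of_domain continuous_on_subset[OF F_continuous_on[OF assms(1) M(2) hyp]]
        inj_on_subset[OF inj]) auto
  moreover have "of_real (r6 m M r) \<in> G4 m M ` ball 0 s"
    using z s by (metis imageI mem_ball_0)
  moreover have "((\<lambda>x. complex_of_real (r6 m M x)) \<longlongrightarrow> of_real (r6 m M r)) (at_left r)"
    using r M DERIV_isCont[OF r6_has_derivative[of M r m]]
    by (intro tendsto_of_real) (auto simp: isCont_def intro: filterlim_at_split[THEN iffD1, THEN conjunct1])
  ultimately have "\<forall>\<^sub>F x in at_left r. complex_of_real (r6 m M x) \<in> G4 m M ` ball 0 s"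
    using topological_tendstoD by blast
  moreover have "\<forall>\<^sub>F x in at_left r. x \<in> {s<..<r}"
    using s by (intro eventually_at_left_real)
  ultimately have "\<forall>\<^sub>F x in at_left r. complex_of_real (r6 m M x) \<in> G4 m M ` ball 0 s \<and> x \<in> {s<..<r}"
    by (rule eventually_conj)
  then obtain x where x: "complex_of_real (r6 m M x) \<in> G4 m M ` ball 0 s" "s < x" "x < r"
    using eventually_happens'[OF trivial_limit_at_left_real] by fastforce
  then obtain w where w: "cmod w < s" "G4 m M w = G4 m M (of_real x)"
    using G4_of_real[of M x m] M s r by auto
  have "w = of_real x"
    by (rule inj_onD[OF inj w(2)]) (use w x s in auto)
  then show False
    using w x s by simp
qed

theorem theorem3p4:
  fixes m :: nat and M :: "nat \<Rightarrow> real"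
  assumes "m \<ge> 1"
    and "\<forall>k\<in>{1..<m}. M k \<ge> 0"
  shows "(\<forall>f F. bloch_hypotheses m M f F \<longrightarrow>
            M 0 > 1 \<and>
            (\<exists>!r. is_r5 m M r) \<and>
            (\<forall>r5. is_r5 m M r5 \<longrightarrow>
               inj_on F (ball 0 r5) \<and>
               contains_schlicht_disk F (ball 0 r5) 0 (r6 m M r5)))
       \<and> (M 0 > 1 \<longrightarrow>
            (\<exists>g. bloch_hypotheses m M g (G4 m M)) \<and>
            (\<exists>!r. is_r5 m M r) \<and>
            (\<forall>r5. is_r5 m M r5 \<longrightarrow>
               (\<forall>r. r5 < r \<and> r \<le> 1 \<longrightarrow> \<not> inj_on (G4 m M) (ball 0 r)) \<and>
               (\<forall>\<rho>. \<rho> > r6 m M r5 \<longrightarrow>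
                  \<not> ball 0 \<rho> \<subseteq> G4 m M ` ball 0 r5)))"
proof (intro conjI allI impI)
  fix f F assume hyp: "bloch_hypotheses m M f F"
  show M0: "M 0 > 1"
    using M0_gt_1[OF assms hyp] .
  show "\<exists>!r. is_r5 m M r"
    using ex1_is_r5[OF M0 assms(2)] .
  fix r5 assume "is_r5 m M r5"
  then show "inj_on F (ball 0 r5)" "contains_schlicht_disk F (ball 0 r5) 0 (r6 m M r5)"
    using F_inj_on[OF assms hyp] F_schlicht[OF assms hyp] by auto
next
  assume M0: "M 0 > 1"
  show "\<exists>g. bloch_hypotheses m M g (G4 m M)"
    using bloch_hypotheses_G4[OF assms M0] .
  show "\<exists>!r. is_r5 m M r"
    using ex1_is_r5[OF M0 assms(2)] .
  fix r5 assume r5: "is_r5 m M r5"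
  show "\<not> inj_on (G4 m M) (ball 0 r)" if "r5 < r \<and> r \<le> 1" for r
    using G4_not_inj_on[OF M0 assms(2) r5] that by blast
  show "\<not> ball 0 \<rho> \<subseteq> G4 m M ` ball 0 r5" if "\<rho> > r6 m M r5" for \<rho>
  proof -
    \<comment> \<open>Positivity makes \<open>r6 m M r5\<close> the modulus of the omitted value,
      which thus lies in every larger disk.\<close>
    have "0 < r6 m M r5"
      using r6_increasing[OF M0 assms(2) r5, of 0] r5 by (simp add: r6_zero is_r5_iff)
    then have "of_real (r6 m M r5) \<in> ball (0 :: complex) \<rho>"
      using that by simp
    then show ?thesis
      using G4_omits_r6[OF assms(1) M0 assms(2) r5] by blast
  qed
qed

end
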